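(* Let $K(x,y)=\sum_{j=0}^{\infty}a_j(y^*x)^j$, $x,y\in\mathbb{B}^n$, be a Krein kernel with real coefficients satisfying $|a_k|<1$ for all $k$ and with at least one $a_k=0$. Then the reproducing kernel Krein space induced by $K$ is a proper subspace (as a vector space of functions) of the reproducing kernel Hilbert space on $\mathbb{B}^n$ induced by the $\omega$-kernel $\omega(x,y)=\frac{1}{1-y^*x}$.
   Context: $\mathbb{B}^n$ is the open complex unit ball in $\mathbb{C}^n$. For a nonnegative semidefinite kernel $k$, $\mathcal{H}(k)$ denotes the reproducing kernel Hilbert space with reproducing kernel $k$. A Krein space is a complex vector space with a Hermitian form $[\cdot,\cdot]$ that decomposes as a $[\cdot,\cdot]$-orthogonal direct sum $\mathcal{K}_+\oplus\mathcal{K}_-$ with $(\mathcal{K}_+,[\cdot,\cdot])$ and $(\mathcal{K}_-,-[\cdot,\cdot])$ Hilbert spaces; a reproducing kernel Krein space is a Krein space of functions with a kernel $K(x,y)=k_y(x)$ such that $k_z$ belongs to the space and $f(z)=[f,k_z]$ for every $f$ in the space and every point $z$. For a Krein kernel $K(x,y)=\sum_j a_j(y^*x)^j$ with real $a_j$, put $K_+=\sum_{a_j>0}a_j(y^*x)^j$ and $K_-=\sum_{a_j<0}a_j(y^*x)^j$. The reproducing kernel Krein space induced by $K$ consists of the functions $f_++f_-$ with $f_+\in\mathcal{H}(K_+)$, $f_-\in\mathcal{H}(-K_-)$. *)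

theory Defs
  imports "HOL-Analysis.Analysis" "HOL-Library.Function_Algebras"
begin

definition cscale_fun :: "complex \<Rightarrow> ('a \<Rightarrow> complex) \<Rightarrow> 'a \<Rightarrow> complex"
  where "cscale_fun c f = (\<lambda>x. c * f x)"

global_interpretation cfun: vector_space "cscale_fun :: complex \<Rightarrow> ('a \<Rightarrow> complex) \<Rightarrow> 'a \<Rightarrow> complex"
  by unfold_locales (auto simp: cscale_fun_def fun_eq_iff algebra_simps)

text \<open>
  Forms are given as functions on all of \<open>'a \<Rightarrow> complex\<close>, but only their values on the carrier
  matter. They are linear in the first argument and conjugate-linear in the second.
\<close>

definition hermitian_form_on ::
    "('a \<Rightarrow> complex) set \<Rightarrow> (('a \<Rightarrow> complex) \<Rightarrow> ('a \<Rightarrow> complex) \<Rightarrow> complex) \<Rightarrow> bool"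
  where "hermitian_form_on V b \<longleftrightarrow>
    (\<forall>f\<in>V. \<forall>g\<in>V. \<forall>h\<in>V. b (f + g) h = b f h + b g h) \<and>
    (\<forall>c. \<forall>f\<in>V. \<forall>g\<in>V. b (cscale_fun c f) g = c * b f g) \<and>
    (\<forall>f\<in>V. \<forall>g\<in>V. b g f = cnj (b f g))"

definition form_norm ::
    "(('a \<Rightarrow> complex) \<Rightarrow> ('a \<Rightarrow> complex) \<Rightarrow> complex) \<Rightarrow> ('a \<Rightarrow> complex) \<Rightarrow> real"
  where "form_norm b f = sqrt (Re (b f f))"

definition hilbert_space_on ::
    "('a \<Rightarrow> complex) set \<Rightarrow> (('a \<Rightarrow> complex) \<Rightarrow> ('a \<Rightarrow> complex) \<Rightarrow> complex) \<Rightarrow> bool"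
  where "hilbert_space_on H b \<longleftrightarrow>
    cfun.subspace H \<and> hermitian_form_on H b \<and>
    (\<forall>f\<in>H. f \<noteq> 0 \<longrightarrow> 0 < Re (b f f)) \<and>
    (\<forall>u. (\<forall>n. u n \<in> H) \<and>
         (\<forall>e>0. \<exists>N. \<forall>m\<ge>N. \<forall>n\<ge>N. form_norm b (u m - u n) < e) \<longrightarrow>
         (\<exists>f\<in>H. (\<lambda>n::nat. form_norm b (u n - f)) \<longlonglongrightarrow> 0))"

definition krein_space_on ::
    "('a \<Rightarrow> complex) set \<Rightarrow> (('a \<Rightarrow> complex) \<Rightarrow> ('a \<Rightarrow> complex) \<Rightarrow> complex) \<Rightarrow> bool"
  where "krein_space_on V b \<longleftrightarrow>
    cfun.subspace V \<and> hermitian_form_on V b \<and>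
    (\<exists>P N. hilbert_space_on P b \<and> hilbert_space_on N (\<lambda>f g. - b f g) \<and>
       V = {f + g |f g. f \<in> P \<and> g \<in> N} \<and> P \<inter> N = {0} \<and>
       (\<forall>f\<in>P. \<forall>g\<in>N. b f g = 0))"

text \<open>
  A function on a set \<open>X\<close> is represented by its extension by zero to the whole type, so that
  equality of representatives is equality of functions on \<open>X\<close>. Accordingly the section
  \<open>k_y = k(\<cdot>, y)\<close> is cut off outside \<open>X\<close>.
\<close>

definition funs_on :: "'a set \<Rightarrow> ('a \<Rightarrow> complex) set"
  where "funs_on X = {f. \<forall>x. x \<notin> X \<longrightarrow> f x = 0}"

definition kernel_section :: "'a set \<Rightarrow> ('a \<Rightarrow> 'a \<Rightarrow> complex) \<Rightarrow> 'a \<Rightarrow> 'a \<Rightarrow> complex"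
  where "kernel_section X k y = (\<lambda>x. if x \<in> X then k x y else 0)"

definition reproducing_on ::
    "'a set \<Rightarrow> ('a \<Rightarrow> 'a \<Rightarrow> complex) \<Rightarrow> ('a \<Rightarrow> complex) set \<Rightarrow>
     (('a \<Rightarrow> complex) \<Rightarrow> ('a \<Rightarrow> complex) \<Rightarrow> complex) \<Rightarrow> bool"
  where "reproducing_on X k V b \<longleftrightarrow>
    V \<subseteq> funs_on X \<and>
    (\<forall>z\<in>X. kernel_section X k z \<in> V \<and> (\<forall>f\<in>V. f z = b f (kernel_section X k z)))"

definition is_rkhs ::
    "'a set \<Rightarrow> ('a \<Rightarrow> 'a \<Rightarrow> complex) \<Rightarrow> ('a \<Rightarrow> complex) set \<Rightarrow>
     (('a \<Rightarrow> complex) \<Rightarrow> ('a \<Rightarrow> complex) \<Rightarrow> complex) \<Rightarrow> bool"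
  where "is_rkhs X k H b \<longleftrightarrow> hilbert_space_on H b \<and> reproducing_on X k H b"

definition is_rkks ::
    "'a set \<Rightarrow> ('a \<Rightarrow> 'a \<Rightarrow> complex) \<Rightarrow> ('a \<Rightarrow> complex) set \<Rightarrow>
     (('a \<Rightarrow> complex) \<Rightarrow> ('a \<Rightarrow> complex) \<Rightarrow> complex) \<Rightarrow> bool"
  where "is_rkks X k V b \<longleftrightarrow> krein_space_on V b \<and> reproducing_on X k V b"

definition krein_kernel :: "'a set \<Rightarrow> ('a \<Rightarrow> 'a \<Rightarrow> complex) \<Rightarrow> bool"
  where "krein_kernel X k \<longleftrightarrow> (\<exists>V b. is_rkks X k V b)"

text \<open>
  The underlying function space of \<open>\<H>(k)\<close>. For positive semidefinite \<open>k\<close> it exists and is unique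
  (Moore--Aronszajn), so the description below denotes it.
\<close>

definition rkhs :: "'a set \<Rightarrow> ('a \<Rightarrow> 'a \<Rightarrow> complex) \<Rightarrow> ('a \<Rightarrow> complex) set"
  where "rkhs X k = (THE H. \<exists>b. is_rkhs X k H b)"

text \<open>\<open>cdot y x\<close> is \<open>y\<^sup>*x\<close>; the library's inner product on \<open>complex ^ 'n\<close> is only the real one.\<close>

definition cdot :: "complex ^ 'n \<Rightarrow> complex ^ 'n \<Rightarrow> complex"
  where "cdot y x = (\<Sum>i\<in>UNIV. cnj (y $ i) * x $ i)"

abbreviation unit_ball :: "(complex ^ 'n) set"
  where "unit_ball \<equiv> ball 0 1"

definition power_kernel :: "(nat \<Rightarrow> real) \<Rightarrow> complex ^ 'n \<Rightarrow> complex ^ 'n \<Rightarrow> complex"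
  where "power_kernel a x y = (\<Sum>j. of_real (a j) * cdot y x ^ j)"

definition power_kernel_pos :: "(nat \<Rightarrow> real) \<Rightarrow> complex ^ 'n \<Rightarrow> complex ^ 'n \<Rightarrow> complex"
  where "power_kernel_pos a = power_kernel (\<lambda>j. if a j > 0 then a j else 0)"

definition power_kernel_neg :: "(nat \<Rightarrow> real) \<Rightarrow> complex ^ 'n \<Rightarrow> complex ^ 'n \<Rightarrow> complex"
  where "power_kernel_neg a = power_kernel (\<lambda>j. if a j < 0 then a j else 0)"

definition induced_rkks :: "(nat \<Rightarrow> real) \<Rightarrow> (complex ^ 'n \<Rightarrow> complex) set"
  where "induced_rkks a =
    {f + g |f g. f \<in> rkhs unit_ball (power_kernel_pos a) \<and>
                 g \<in> rkhs unit_ball (\<lambda>x y. - power_kernel_neg a x y)}"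

definition omega_kernel :: "complex ^ 'n \<Rightarrow> complex ^ 'n \<Rightarrow> complex"
  where "omega_kernel x y = 1 / (1 - cdot y x)"

end

theory Submission imports Defs begin

text \<open>
  For coefficients \<open>0 \<le> a\<^sub>j \<le> 1\<close> the space \<open>\<H>(k)\<close> of the kernel \<open>k(x,y) = \<Sum>\<^sub>j a\<^sub>j (y\<^sup>*x)\<^sup>j\<close> is
  described explicitly.  Expanding \<open>(y\<^sup>*x)\<^sup>j\<close> over the words \<open>w\<close> of length \<open>j\<close> in the coordinates
  exhibits \<open>k\<close> as an inner product of two square-summable families, with entries
  \<open>sqrt (a\<^sub>j)\<close> times a conjugated monomial.  A kernel of this form has as its reproducing kernel
  Hilbert space the set of all functions
    \<open>x \<mapsto> \<Sum>\<^sub>w c\<^sub>w sqrt (a\<^bsub>|w|\<^esub>) x\<^sup>w\<close>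
  with \<open>c\<close> square-summable (\<open>rkhs_feature_map\<close>, \<open>rkhs_power_kernel\<close>).  Because \<open>rkhs\<close> is a definite
  description, this needs the uniqueness of the Hilbert space with a given kernel (\<open>rkhs_subset\<close>),
  which rests on orthogonal projection (\<open>projection\<close>).

  The kernel \<open>\<omega>\<close> is the case in which all coefficients are one.  Since \<open>sqrt (a\<^sub>j) \<le> 1\<close>, the weights
  can be absorbed into \<open>c\<close>, so \<open>\<H>(K\<^sub>+)\<close> and \<open>\<H>(-K\<^sub>-)\<close> are subspaces of \<open>\<H>(\<omega>)\<close>, and so is their sum.

  The sum is proper.  If \<open>a\<^sub>k = 0\<close>, then neither \<open>K\<^sub>+\<close> nor \<open>K\<^sub>-\<close> has a term of degree \<open>k\<close>, and the
  restriction to a coordinate axis of any function in the sum is a power series in one variable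
  without a term of degree \<open>k\<close> (\<open>word_series_axis_sums\<close>).  The monomial \<open>x\<^sub>i\<^sup>k\<close> belongs to \<open>\<H>(\<omega>)\<close>
  and does have this term.
\<close>

section \<open>Inner products on spaces of functions\<close>

locale hilbert_fun =
  fixes H :: "('a \<Rightarrow> complex) set"
    and b :: "('a \<Rightarrow> complex) \<Rightarrow> ('a \<Rightarrow> complex) \<Rightarrow> complex"
  assumes hilbert: "hilbert_space_on H b"
begin

lemma subspace: "cfun.subspace H"
  using hilbert by (simp add: hilbert_space_on_def)

lemmas mem = cfun.subspace_0[OF subspace] cfun.subspace_add[OF subspace]
  cfun.subspace_diff[OF subspace] cfun.subspace_scale[OF subspace]

lemma add_left: "f \<in> H \<Longrightarrow> g \<in> H \<Longrightarrow> h \<in> H \<Longrightarrow> b (f + g) h = b f h + b g h"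
  using hilbert unfolding hilbert_space_on_def hermitian_form_on_def by blast

lemma scale_left: "f \<in> H \<Longrightarrow> g \<in> H \<Longrightarrow> b (cscale_fun c f) g = c * b f g"
  using hilbert unfolding hilbert_space_on_def hermitian_form_on_def by blast

lemma conj_sym: "f \<in> H \<Longrightarrow> g \<in> H \<Longrightarrow> b g f = cnj (b f g)"
  using hilbert unfolding hilbert_space_on_def hermitian_form_on_def by blast

lemma pos: "f \<in> H \<Longrightarrow> f \<noteq> 0 \<Longrightarrow> 0 < Re (b f f)"
  using hilbert by (simp add: hilbert_space_on_def)

lemma complete:
  assumes "\<And>n::nat. u n \<in> H"
    and "\<And>e. e > 0 \<Longrightarrow> \<exists>N. \<forall>m\<ge>N. \<forall>n\<ge>N. form_norm b (u m - u n) < e"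
  obtains f where "f \<in> H" "(\<lambda>n. form_norm b (u n - f)) \<longlonglongrightarrow> 0"
  using hilbert assms unfolding hilbert_space_on_def by blast

lemma diff_left:
  assumes "f \<in> H" "g \<in> H" "h \<in> H" shows "b (f - g) h = b f h - b g h"
  using add_left[of "f - g" g h] assms mem by simp

lemma add_right:
  assumes "f \<in> H" "g \<in> H" "h \<in> H" shows "b h (f + g) = b h f + b h g"
  using conj_sym[of "f + g" h] conj_sym[of f h] conj_sym[of g h] add_left[of f g h] assms mem by simp

lemma scale_right:
  assumes "f \<in> H" "g \<in> H" shows "b f (cscale_fun c g) = cnj c * b f g"
  using conj_sym[of "cscale_fun c g" f] conj_sym[of g f] scale_left[of g f c] assms mem by simp

lemma diff_right:
  assumes "f \<in> H" "g \<in> H" "h \<in> H" shows "b h (f - g) = b h f - b h g"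
  using add_right[of "f - g" g h] assms mem by simp

lemma zero_left: "f \<in> H \<Longrightarrow> b 0 f = 0"
  using add_left[of 0 0 f] mem(1) by simp

lemma zero_right: "f \<in> H \<Longrightarrow> b f 0 = 0"
  using conj_sym[of 0 f] zero_left mem(1) by simp

lemma nonneg: "f \<in> H \<Longrightarrow> 0 \<le> Re (b f f)"
  using pos[of f] zero_left[of 0] mem(1) by (cases "f = 0") auto

lemma self_real: "f \<in> H \<Longrightarrow> b f f = complex_of_real (Re (b f f))"
  using conj_sym[of f f] by (metis Reals_cnj_iff of_real_Re)

lemma norm_sq: "f \<in> H \<Longrightarrow> (form_norm b f)\<^sup>2 = Re (b f f)"
  by (simp add: form_norm_def nonneg)

lemma norm_nonneg: "f \<in> H \<Longrightarrow> 0 \<le> form_norm b f"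
  by (simp add: form_norm_def nonneg)

lemma norm_minus_commute:
  assumes "f \<in> H" "g \<in> H" shows "form_norm b (f - g) = form_norm b (g - f)"
  using assms mem by (simp add: form_norm_def diff_left diff_right algebra_simps)

text \<open>The multiple \<open>c g\<close> subtracted here is the orthogonal projection of \<open>f\<close> onto the line
  through \<open>g\<close>, so the right-hand side is the least value of the squared norm along that line.
  Nonnegativity of this value is the Cauchy--Schwarz inequality; near-minimality of \<open>f\<close> itself
  forces \<open>b f g\<close> to be small, which is how it enters the projection theorem.\<close>

lemma best_multiple:
  assumes f: "f \<in> H" and g: "g \<in> H" and G: "Re (b g g) > 0"
  defines "c \<equiv> b f g / complex_of_real (Re (b g g))"
  shows "Re (b (f - cscale_fun c g) (f - cscale_fun c g))
    = Re (b f f) - (cmod (b f g))\<^sup>2 / Re (b g g)"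
proof -
  have 1: "b (f - cscale_fun c g) (f - cscale_fun c g)
      = b f f - cnj c * b f g - c * cnj (b f g) + c * cnj c * b g g"
    using f g mem conj_sym[of f g]
    by (simp add: diff_left diff_right scale_left scale_right algebra_simps)
  have 2: "cnj c * b f g = complex_of_real ((cmod (b f g))\<^sup>2 / Re (b g g))"
    by (simp add: c_def complex_norm_square[symmetric] mult.commute[of "cnj _"])
  have "c * cnj c * b g g = c * cnj c * complex_of_real (Re (b g g))"
    by (rule arg_cong[OF self_real[OF g]])
  also have "\<dots> = c * cnj (b f g)"
    using G by (simp add: c_def)
  finally have 3: "c * cnj c * b g g = c * cnj (b f g)" .
  show ?thesis unfolding 1 3 using 2 by simp
qed

lemma cauchy_schwarz:
  assumes f: "f \<in> H" and g: "g \<in> H"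
  shows "cmod (b f g) \<le> form_norm b f * form_norm b g"
proof (cases "g = 0")
  case True
  then show ?thesis using f zero_right norm_nonneg mem by simp
next
  case False
  then have G: "Re (b g g) > 0" using pos g by simp
  have "0 \<le> Re (b f f) - (cmod (b f g))\<^sup>2 / Re (b g g)"
    using best_multiple[OF f g G] nonneg f g mem by metis
  then have "(cmod (b f g))\<^sup>2 \<le> Re (b f f) * Re (b g g)"
    using G by (simp add: field_simps)
  also have "\<dots> = (form_norm b f * form_norm b g)\<^sup>2"
    using f g by (simp add: power_mult_distrib norm_sq)
  finally show ?thesis
    using norm_nonneg f g by (simp add: abs_le_square_iff[symmetric])
qed

lemma parallelogram:
  assumes "f \<in> H" "g \<in> H"
  shows "Re (b (f - g) (f - g)) + Re (b (f + g) (f + g)) = 2 * Re (b f f) + 2 * Re (b g g)"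
  using assms mem by (simp add: diff_left diff_right add_left add_right)

lemma triangle:
  assumes f: "f \<in> H" and g: "g \<in> H"
  shows "form_norm b (f - g) \<le> form_norm b f + form_norm b g"
proof -
  have "(form_norm b (f - g))\<^sup>2 = Re (b f f) + Re (b g g) - 2 * Re (b f g)"
    using f g mem conj_sym[of f g] by (simp add: norm_sq diff_left diff_right)
  also have "\<dots> \<le> Re (b f f) + Re (b g g) + 2 * (form_norm b f * form_norm b g)"
    using cauchy_schwarz[OF f g] abs_Re_le_cmod[of "b f g"] by linarith
  also have "\<dots> = (form_norm b f + form_norm b g)\<^sup>2"
    using f g by (simp add: power2_sum norm_sq)
  finally show ?thesis
    using norm_nonneg f g mem by (simp add: abs_le_square_iff[symmetric])
qed

lemma tendsto_left:
  assumes s: "\<And>n. s n \<in> H" and g: "g \<in> H" and h: "h \<in> H"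
    and lim: "(\<lambda>n. form_norm b (s n - g)) \<longlonglongrightarrow> 0"
  shows "(\<lambda>n. b (s n) h) \<longlonglongrightarrow> b g h"
proof -
  have "(\<lambda>n. b (s n) h - b g h) \<longlonglongrightarrow> 0"
  proof (rule Lim_null_comparison)
    show "\<forall>\<^sub>F n in sequentially. norm (b (s n) h - b g h) \<le> form_norm b (s n - g) * form_norm b h"
      using cauchy_schwarz[of "s _ - g" h] s g h mem by (simp add: diff_left[symmetric])
    show "(\<lambda>n. form_norm b (s n - g) * form_norm b h) \<longlonglongrightarrow> 0"
      using tendsto_mult_right[OF lim, of "form_norm b h"] by simp
  qed
  then show ?thesis by (simp add: LIM_zero_iff)
qed

lemma convergent_Cauchy:
  assumes s: "\<And>n. s n \<in> H" and g: "g \<in> H"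
    and lim: "(\<lambda>n. form_norm b (s n - g)) \<longlonglongrightarrow> 0" and e: "e > 0"
  shows "\<exists>N. \<forall>m\<ge>N. \<forall>n\<ge>N. form_norm b (s m - s n) < e"
proof -
  obtain N where N: "\<And>n. n \<ge> N \<Longrightarrow> form_norm b (s n - g) < e / 2"
    using LIMSEQ_D[OF lim, of "e / 2"] e by fastforce
  have "form_norm b (s m - s n) < e" if "m \<ge> N" "n \<ge> N" for m n
    using triangle[of "s m - g" "s n - g"] N[OF that(1)] N[OF that(2)] s g mem by simp
  then show ?thesis by blast
qed

text \<open>Orthogonal projection onto the closure of a subspace \<open>S\<close>.  A sequence in \<open>S\<close> whose distance
  to \<open>f\<close> approaches the infimum is Cauchy by the parallelogram law; its limit \<open>g\<close> need not lie in
  \<open>S\<close>, which is why the sequence is part of the conclusion.\<close>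

lemma projection:
  assumes S: "cfun.subspace S" and SH: "S \<subseteq> H" and f: "f \<in> H"
  obtains s g where "\<And>n::nat. s n \<in> S" "g \<in> H"
    "(\<lambda>n. form_norm b (s n - g)) \<longlonglongrightarrow> 0" "\<And>t. t \<in> S \<Longrightarrow> b (f - g) t = 0"
proof -
  define Q where "Q h = Re (b h h)" for h
  define d where "d = (INF s\<in>S. Q (f - s))"
  have bdd: "bdd_below ((\<lambda>s. Q (f - s)) ` S)"
    using nonneg f SH mem unfolding Q_def by (intro bdd_belowI[of _ 0]) auto
  have d_le: "d \<le> Q (f - s)" if "s \<in> S" for s
    unfolding d_def using bdd that by (rule cINF_lower)
  have ne: "S \<noteq> {}" using cfun.subspace_0[OF S] by auto
  have "\<exists>s\<in>S. Q (f - s) < d + 1 / real (Suc n)" for n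
    using cINF_less_iff[OF ne bdd, of "d + 1 / real (Suc n)"] unfolding d_def[symmetric] by simp
  then obtain s where s: "\<And>n. s n \<in> S" and sQ: "\<And>n. Q (f - s n) < d + 1 / real (Suc n)"
    by metis
  have sH: "s n \<in> H" for n using s SH by auto
  have cauchy: "Q (s m - s n) \<le> 2 / real (Suc m) + 2 / real (Suc n)" for m n
  proof -
    define h where "h = cscale_fun (1/2) (s m + s n)"
    \<comment> \<open>The midpoint \<open>h\<close> competes for the infimum, so its squared distance to \<open>f\<close> is at least \<open>d\<close>.\<close>
    have hS: "h \<in> S" using cfun.subspace_scale[OF S] cfun.subspace_add[OF S] s by (simp add: h_def)
    have "(f - s m) - (f - s n) = s n - s m" by simp
    moreover have "(f - s m) + (f - s n) = cscale_fun 2 (f - h)"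
      by (simp add: h_def cscale_fun_def fun_eq_iff field_simps)
    moreover have "f - h \<in> H" using hS SH f mem by auto
    ultimately have "Q (s n - s m) = 2 * Q (f - s m) + 2 * Q (f - s n) - 4 * Q (f - h)"
      using parallelogram[of "f - s m" "f - s n"] sH f mem
      by (simp add: Q_def scale_left scale_right)
    moreover have "Q (s n - s m) = Q (s m - s n)"
      using norm_minus_commute[OF sH sH] by (simp add: Q_def form_norm_def)
    ultimately show ?thesis using sQ[of m] sQ[of n] d_le[OF hS] by (simp add: algebra_simps)
  qed
  have "\<exists>N. \<forall>m\<ge>N. \<forall>n\<ge>N. form_norm b (s m - s n) < e" if e: "e > 0" for e
  proof -
    obtain N where N: "4 / e\<^sup>2 < real N" using reals_Archimedean2 by blast
    have small: "2 / real (Suc n) < e\<^sup>2 / 2" if "n \<ge> N" for n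
    proof -
      have "4 < real N * e\<^sup>2" using N e by (simp add: divide_less_eq)
      also have "\<dots> \<le> real (Suc n) * e\<^sup>2" using that by (intro mult_right_mono) auto
      finally show ?thesis by (simp add: field_simps)
    qed
    have "form_norm b (s m - s n) < e" if "m \<ge> N" "n \<ge> N" for m n
    proof -
      have "(form_norm b (s m - s n))\<^sup>2 < e\<^sup>2"
        using cauchy[of m n] small[OF that(1)] small[OF that(2)] norm_sq[of "s m - s n"] sH mem
        by (simp add: Q_def)
      then show ?thesis using e by (simp add: power2_less_imp_less)
    qed
    then show ?thesis by blast
  qed
  then obtain g where g: "g \<in> H" and lim: "(\<lambda>n. form_norm b (s n - g)) \<longlonglongrightarrow> 0"
    using complete[of s] sH by blast
  have "b (f - g) t = 0" if t: "t \<in> S" for t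
  proof (cases "t = 0")
    case True
    then show ?thesis using f g mem zero_right by simp
  next
    case False
    have tH: "t \<in> H" using t SH by auto
    then have T: "Q t > 0" using pos False by (simp add: Q_def)
    \<comment> \<open>Correcting \<open>s n\<close> by the best multiple of \<open>t\<close> cannot bring the squared distance below \<open>d\<close>.\<close>
    have le: "(cmod (b (f - s n) t))\<^sup>2 \<le> Q t * (1 / real (Suc n))" for n
    proof -
      define c where "c = b (f - s n) t / complex_of_real (Q t)"
      have "s n + cscale_fun c t \<in> S"
        using cfun.subspace_scale[OF S] cfun.subspace_add[OF S] s t by simp
      then have "d \<le> Q (f - (s n + cscale_fun c t))" by (rule d_le)
      also have "f - (s n + cscale_fun c t) = f - s n - cscale_fun c t" by simp
      also have "Q (f - s n - cscale_fun c t) = Q (f - s n) - (cmod (b (f - s n) t))\<^sup>2 / Q t"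
        unfolding Q_def c_def
        by (rule best_multiple) (use f sH tH mem T in \<open>auto simp: Q_def\<close>)
      finally have "(cmod (b (f - s n) t))\<^sup>2 / Q t \<le> 1 / real (Suc n)"
        using sQ[of n] by linarith
      then show ?thesis using T by (simp add: field_simps)
    qed
    have "(\<lambda>n. (cmod (b (f - s n) t))\<^sup>2) \<longlonglongrightarrow> 0"
    proof (rule tendsto_sandwich[OF _ _ tendsto_const])
      show "(\<lambda>n. Q t * (1 / real (Suc n))) \<longlonglongrightarrow> 0"
        using tendsto_mult_right_zero[OF LIMSEQ_Suc[OF lim_1_over_n], of "Q t"] by simp
    qed (use le in auto)
    moreover have "(\<lambda>n. b (s n) t) \<longlonglongrightarrow> b g t"
      by (rule tendsto_left) (use sH g tH lim in auto)
    then have "(\<lambda>n. (cmod (b (f - s n) t))\<^sup>2) \<longlonglongrightarrow> (cmod (b f t - b g t))\<^sup>2"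
      using f sH tH by (simp add: diff_left) (intro tendsto_intros)
    ultimately have "(cmod (b f t - b g t))\<^sup>2 = 0"
      using LIMSEQ_unique by blast
    then show ?thesis using f g tH by (simp add: diff_left)
  qed
  with s g lim that show ?thesis by blast
qed

lemma orthogonal_complement_hilbert:
  assumes N: "N \<subseteq> H"
  shows "hilbert_space_on {m \<in> H. \<forall>n\<in>N. b m n = 0} b"
proof -
  let ?M = "{m \<in> H. \<forall>n\<in>N. b m n = 0}"
  have "cfun.subspace ?M"
    using N mem by (auto simp: cfun.subspace_def add_left scale_left zero_left subset_iff)
  moreover have "hermitian_form_on ?M b"
    using add_left scale_left conj_sym unfolding hermitian_form_on_def by blast
  moreover have "\<exists>f\<in>?M. (\<lambda>n::nat. form_norm b (u n - f)) \<longlonglongrightarrow> 0"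
    if u: "\<forall>n. u n \<in> ?M"
      and c: "\<forall>e>0. \<exists>N. \<forall>m\<ge>N. \<forall>n\<ge>N. form_norm b (u m - u n) < e" for u
  proof -
    obtain f where f: "f \<in> H" and lim: "(\<lambda>n. form_norm b (u n - f)) \<longlonglongrightarrow> 0"
      using complete[of u] u c by auto
    have "b f t = 0" if t: "t \<in> N" for t
    proof -
      have "(\<lambda>n. b (u n) t) \<longlonglongrightarrow> b f t"
        by (rule tendsto_left) (use u f t N lim in auto)
      moreover have "(\<lambda>n. b (u n) t) = (\<lambda>n. 0)" using u t by auto
      ultimately show ?thesis using LIMSEQ_unique tendsto_const by metis
    qed
    then show ?thesis using f lim by auto
  qed
  ultimately show ?thesis
    unfolding hilbert_space_on_def using pos by blast
qed

text \<open>Moves a Hilbert space structure along a linear bijection.  It serves to turn a space of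
  coefficient families into the space of functions that they represent.\<close>

lemma hilbert_transport:
  assumes add: "\<And>f g. f \<in> H \<Longrightarrow> g \<in> H \<Longrightarrow> T (f + g) = T f + T g"
    and scale: "\<And>c f. f \<in> H \<Longrightarrow> T (cscale_fun c f) = cscale_fun c (T f)"
    and inj: "inj_on T H"
  shows "hilbert_space_on (T ` H) (\<lambda>f g. b (inv_into H T f) (inv_into H T g))"
proof -
  let ?i = "inv_into H T" let ?b = "\<lambda>f g. b (?i f) (?i g)"
  have i: "?i (T f) = f" if "f \<in> H" for f using inj that by (rule inv_into_f_f)
  have T0: "T 0 = 0" using add[of 0 0] mem(1) by simp
  have diff: "T (f - g) = T f - T g" if "f \<in> H" "g \<in> H" for f g
    using add[of "f - g" g] that mem by simp
  have sub: "cfun.subspace (T ` H)"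
    unfolding cfun.subspace_def
  proof (intro conjI ballI allI)
    show "0 \<in> T ` H" using T0 mem(1) by (metis imageI)
    show "x + y \<in> T ` H" if "x \<in> T ` H" "y \<in> T ` H" for x y
      using that mem(2) add by (metis (no_types, lifting) imageE imageI)
    show "cscale_fun c x \<in> T ` H" if "x \<in> T ` H" for c x
      using that mem(4) scale by (metis (no_types, lifting) imageE imageI)
  qed
  have herm: "hermitian_form_on (T ` H) ?b"
    unfolding hermitian_form_on_def
  proof (intro conjI ballI allI)
    show "?b (f + g) h = ?b f h + ?b g h" if "f \<in> T ` H" "g \<in> T ` H" "h \<in> T ` H" for f g h
      using that mem by (auto simp: add[symmetric] i add_left)
    show "?b (cscale_fun c f) g = c * ?b f g" if "f \<in> T ` H" "g \<in> T ` H" for c f g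
      using that mem by (auto simp: scale[symmetric] i scale_left)
    show "?b g f = cnj (?b f g)" if "f \<in> T ` H" "g \<in> T ` H" for f g
      using that by (auto simp: i intro: conj_sym)
  qed
  have pos': "0 < Re (?b f f)" if "f \<in> T ` H" "f \<noteq> 0" for f
    using that pos T0 by (metis i imageE)
  have "\<exists>f\<in>T ` H. (\<lambda>n::nat. form_norm ?b (u n - f)) \<longlonglongrightarrow> 0"
    if u: "\<forall>n. u n \<in> T ` H"
      and c: "\<forall>e>0. \<exists>N. \<forall>m\<ge>N. \<forall>n\<ge>N. form_norm ?b (u m - u n) < e" for u
  proof -
    from u obtain v where v: "\<And>n. v n \<in> H" and uv: "\<And>n. u n = T (v n)"
      unfolding image_iff by metis
    have n: "form_norm ?b (T f - T g) = form_norm b (f - g)" if "f \<in> H" "g \<in> H" for f g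
      using that mem by (simp add: form_norm_def diff[symmetric] i)
    have "\<exists>N. \<forall>m\<ge>N. \<forall>n\<ge>N. form_norm b (v m - v n) < e" if "e > 0" for e
      using c that by (simp add: uv n v)
    then obtain f where "f \<in> H" "(\<lambda>n. form_norm b (v n - f)) \<longlonglongrightarrow> 0"
      using complete[of v] v by blast
    then show ?thesis by (intro bexI[of _ "T f"]) (auto simp: uv n v)
  qed
  then show ?thesis
    unfolding hilbert_space_on_def using sub herm pos' by blast
qed

end

section \<open>Reproducing kernel Hilbert spaces\<close>

text \<open>Uniqueness of the reproducing kernel Hilbert space.  A function orthogonal to every kernel
  section vanishes on \<open>X\<close>, so the span of the sections is dense in \<open>H\<close>.  On that span both inner
  products are dictated by the kernel.  A sequence in the span that converges to \<open>f\<close> in \<open>H\<close> is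
  therefore Cauchy in \<open>H'\<close> as well, and its limit there is \<open>f\<close> again because norm convergence
  implies pointwise convergence in both spaces.\<close>

lemma rkhs_subset:
  assumes 1: "is_rkhs X k H b" and 2: "is_rkhs X k H' b'"
  shows "H \<subseteq> H'"
proof
  interpret A: hilbert_fun H b using 1 by unfold_locales (simp add: is_rkhs_def)
  interpret B: hilbert_fun H' b' using 2 by unfold_locales (simp add: is_rkhs_def)
  let ?k = "kernel_section X k"
  let ?S = "cfun.span (?k ` X)"
  have rA: "?k z \<in> H" "f \<in> H \<Longrightarrow> f z = b f (?k z)" if "z \<in> X" for z f
    using 1 that by (auto simp: is_rkhs_def reproducing_on_def)
  have rB: "?k z \<in> H'" "f \<in> H' \<Longrightarrow> f z = b' f (?k z)" if "z \<in> X" for z f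
    using 2 that by (auto simp: is_rkhs_def reproducing_on_def)
  have off: "f \<in> H \<union> H' \<Longrightarrow> z \<notin> X \<Longrightarrow> f z = 0" for f z
    using 1 2 by (auto simp: is_rkhs_def reproducing_on_def funs_on_def)
  have SA: "?S \<subseteq> H" by (rule cfun.span_minimal) (use rA A.subspace in auto)
  have SB: "?S \<subseteq> H'" by (rule cfun.span_minimal) (use rB B.subspace in auto)
  have eq: "b s t = b' s t" if s: "s \<in> ?S" and t: "t \<in> ?S" for s t
  proof -
    have sA: "s \<in> H" and sB: "s \<in> H'" using s SA SB by auto
    have "?S \<subseteq> {t \<in> H \<inter> H'. b s t = b' s t}"
    proof (rule cfun.span_minimal)
      show "cfun.subspace {t \<in> H \<inter> H'. b s t = b' s t}"
        using sA sB A.mem B.mem unfolding cfun.subspace_def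
        by (auto simp: A.add_right B.add_right A.scale_right B.scale_right A.zero_right B.zero_right)
      show "?k ` X \<subseteq> {t \<in> H \<inter> H'. b s t = b' s t}"
        using rA(1) rB(1) rA(2)[OF _ sA] rB(2)[OF _ sB] by auto
    qed
    then show ?thesis using t by blast
  qed
  fix f assume f: "f \<in> H"
  obtain s g where s: "\<And>n::nat. s n \<in> ?S" and g: "g \<in> H"
    and lim: "(\<lambda>n. form_norm b (s n - g)) \<longlonglongrightarrow> 0"
    and orth: "\<And>t. t \<in> ?S \<Longrightarrow> b (f - g) t = 0"
    using A.projection[OF cfun.subspace_span SA f] by blast
  have fg: "f z = g z" if z: "z \<in> X" for z
    using orth[of "?k z"] rA[OF z] z f g A.diff_left[of f g "?k z"] by (simp add: cfun.span_base)
  have sA: "s n \<in> H" and sB: "s n \<in> H'" for n using s SA SB by auto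
  have "form_norm b (s m - s n) = form_norm b' (s m - s n)" for m n
    using eq s by (simp add: form_norm_def cfun.span_diff)
  then have "\<exists>N. \<forall>m\<ge>N. \<forall>n\<ge>N. form_norm b' (s m - s n) < e" if "e > 0" for e
    using A.convergent_Cauchy[of s g e] sA g lim that by simp
  then obtain h where h: "h \<in> H'" and lim': "(\<lambda>n. form_norm b' (s n - h)) \<longlonglongrightarrow> 0"
    using B.complete[of s] sB by blast
  have "g z = h z" if z: "z \<in> X" for z
  proof -
    have "(\<lambda>n. b (s n) (?k z)) \<longlonglongrightarrow> b g (?k z)"
      by (rule A.tendsto_left) (use sA g rA z lim in auto)
    then have "(\<lambda>n. s n z) \<longlonglongrightarrow> g z" using rA[OF z] sA g by simp
    moreover have "(\<lambda>n. b' (s n) (?k z)) \<longlonglongrightarrow> b' h (?k z)"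
      by (rule B.tendsto_left) (use sB h rB z lim' in auto)
    then have "(\<lambda>n. s n z) \<longlonglongrightarrow> h z" using rB[OF z] sB h by simp
    ultimately show ?thesis by (rule LIMSEQ_unique)
  qed
  then have "f = h" using fg off f h by (intro ext) (metis UnCI)
  then show "f \<in> H'" using h by simp
qed

lemma rkhs_eqI:
  assumes "is_rkhs X k H b" shows "rkhs X k = H"
  unfolding rkhs_def
proof (rule the_equality)
  show "\<exists>b. is_rkhs X k H b" using assms by blast
  show "H' = H" if "\<exists>b. is_rkhs X k H' b" for H'
    using that assms rkhs_subset by blast
qed

text \<open>With a feature map \<open>\<phi>\<close> into an inner product space, \<open>c\<close> is read as a function on \<open>X\<close>,
  extended by zero like all functions on \<open>X\<close> here.\<close>

definition pullback :: "'a set \<Rightarrow> (('i \<Rightarrow> complex) \<Rightarrow> ('i \<Rightarrow> complex) \<Rightarrow> complex) \<Rightarrow>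
    ('a \<Rightarrow> 'i \<Rightarrow> complex) \<Rightarrow> ('i \<Rightarrow> complex) \<Rightarrow> 'a \<Rightarrow> complex"
  where "pullback X ip \<phi> c = (\<lambda>x. if x \<in> X then ip c (\<phi> x) else 0)"

text \<open>The reproducing kernel Hilbert space of a kernel that factors through a feature map.  The map
  \<open>pullback X b \<phi>\<close> may have a kernel \<open>N\<close>; it consists of the vectors orthogonal to all features.
  Projecting onto \<open>N\<close> shows that the orthogonal complement \<open>M\<close> of \<open>N\<close> has the same image as \<open>H\<close>.
  On \<open>M\<close> the map is injective, and \<open>M\<close> contains every feature, so the Hilbert structure of \<open>M\<close>
  carried over to the image is reproducing.\<close>

theorem (in hilbert_fun) rkhs_feature_map:
  assumes \<phi>: "\<And>x. x \<in> X \<Longrightarrow> \<phi> x \<in> H"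
    and k: "\<And>x y. x \<in> X \<Longrightarrow> y \<in> X \<Longrightarrow> k x y = b (\<phi> y) (\<phi> x)"
  shows "rkhs X k = pullback X b \<phi> ` H"
    and "cfun.subspace (pullback X b \<phi> ` H)"
proof -
  let ?F = "pullback X b \<phi>"
  have F_add: "?F (f + g) = ?F f + ?F g" if "f \<in> H" "g \<in> H" for f g
    using that \<phi> by (auto simp: pullback_def fun_eq_iff add_left)
  have F_scale: "?F (cscale_fun c f) = cscale_fun c (?F f)" if "f \<in> H" for c f
  proof
    show "?F (cscale_fun c f) x = cscale_fun c (?F f) x" for x
      unfolding cscale_fun_def[of c "?F f"] using that \<phi> by (simp add: pullback_def scale_left)
  qed
  have F_diff: "?F (f - g) = ?F f - ?F g" if "f \<in> H" "g \<in> H" for f g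
    using F_add[of "f - g" g] that mem by simp
  have F0: "?F 0 = 0" using F_add[of 0 0] mem(1) by simp
  define N where "N = {c \<in> H. ?F c = 0}"
  define M where "M = {m \<in> H. \<forall>n\<in>N. b m n = 0}"
  have N_iff: "c \<in> N \<longleftrightarrow> c \<in> H \<and> (\<forall>x\<in>X. b c (\<phi> x) = 0)" for c
    by (auto simp: N_def pullback_def fun_eq_iff)
  have NH: "N \<subseteq> H" by (auto simp: N_def)
  have N_sub: "cfun.subspace N"
    unfolding cfun.subspace_def using mem F0 cfun.scale_zero_right
    by (auto simp: N_def F_add F_scale)
  have MH: "M \<subseteq> H" by (auto simp: M_def)
  interpret M: hilbert_fun M b
    by unfold_locales (use orthogonal_complement_hilbert[OF NH] in \<open>simp add: M_def\<close>)
  have \<phi>M: "\<phi> x \<in> M" if x: "x \<in> X" for x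
    using \<phi>[OF x] x NH conj_sym[OF _ \<phi>[OF x]] by (auto simp: M_def N_iff)
  have inj: "inj_on ?F M"
  proof (rule inj_onI)
    fix f g assume f: "f \<in> M" and g: "g \<in> M" and eq: "?F f = ?F g"
    have "f \<in> H" "g \<in> H" using f g MH by auto
    then have "f - g \<in> N" using F_diff[of f g] eq mem by (simp add: N_def)
    moreover have "f - g \<in> M" using M.mem f g by simp
    ultimately have "b (f - g) (f - g) = 0" by (auto simp: M_def)
    then show "f = g" using M.pos[OF \<open>f - g \<in> M\<close>] by auto
  qed
  have split: "?F f \<in> ?F ` M" if f: "f \<in> H" for f
  proof -
    obtain s g where s: "\<And>n::nat. s n \<in> N" and g: "g \<in> H"
      and lim: "(\<lambda>n. form_norm b (s n - g)) \<longlonglongrightarrow> 0"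
      and orth: "\<And>t. t \<in> N \<Longrightarrow> b (f - g) t = 0"
      using projection[OF N_sub NH f] by blast
    \<comment> \<open>\<open>N\<close> is closed, so the limit \<open>g\<close> belongs to it and contributes nothing to the image.\<close>
    have "b g (\<phi> x) = 0" if x: "x \<in> X" for x
    proof -
      have "(\<lambda>n. b (s n) (\<phi> x)) \<longlonglongrightarrow> b g (\<phi> x)"
        by (rule tendsto_left) (use s NH g \<phi> x lim in auto)
      moreover have "(\<lambda>n. b (s n) (\<phi> x)) = (\<lambda>n. 0)" using s x by (auto simp: N_iff)
      ultimately show ?thesis using LIMSEQ_unique tendsto_const by metis
    qed
    then have "?F g = 0" by (auto simp: pullback_def fun_eq_iff)
    then have "?F f = ?F (f - g)" using F_diff f g by simp
    moreover have "f - g \<in> M" using orth f g mem by (simp add: M_def)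
    ultimately show ?thesis by blast
  qed
  have img: "?F ` H = ?F ` M" using split MH by blast
  let ?b = "\<lambda>f g. b (inv_into M ?F f) (inv_into M ?F g)"
  have hil: "hilbert_space_on (?F ` H) ?b"
    unfolding img by (rule M.hilbert_transport) (use F_add F_scale MH inj in \<open>auto simp: subset_iff\<close>)
  have sec: "kernel_section X k z = ?F (\<phi> z)" if "z \<in> X" for z
    using k that by (auto simp: kernel_section_def pullback_def fun_eq_iff)
  have "reproducing_on X k (?F ` H) ?b"
    unfolding reproducing_on_def
  proof (intro conjI ballI)
    show "?F ` H \<subseteq> funs_on X" by (auto simp: pullback_def funs_on_def)
    fix z assume z: "z \<in> X"
    show "kernel_section X k z \<in> ?F ` H" using sec[OF z] \<phi>[OF z] by simp
    fix f assume "f \<in> ?F ` H"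
    then obtain m where m: "m \<in> M" and f: "f = ?F m" unfolding img by blast
    show "f z = ?b f (kernel_section X k z)"
      unfolding sec[OF z] f inv_into_f_f[OF inj m] inv_into_f_f[OF inj \<phi>M[OF z]]
      using z by (simp add: pullback_def)
  qed
  with hil have "is_rkhs X k (?F ` H) ?b" by (simp add: is_rkhs_def)
  then show "rkhs X k = ?F ` H" by (rule rkhs_eqI)
  show "cfun.subspace (?F ` H)" using hil by (simp add: hilbert_space_on_def)
qed

section \<open>Square-summable families\<close>

definition ell2 :: "('i \<Rightarrow> complex) set"
  where "ell2 = {c. (\<lambda>i. (cmod (c i))\<^sup>2) summable_on UNIV}"

definition ell2_ip :: "('i \<Rightarrow> complex) \<Rightarrow> ('i \<Rightarrow> complex) \<Rightarrow> complex"
  where "ell2_ip c d = (\<Sum>\<^sub>\<infinity>i. c i * cnj (d i))"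

text \<open>The comparison behind the inclusion of the function spaces: multiplying a family by factors
  of modulus at most one stays in \<open>ell2\<close>.\<close>

lemma ell2_dominated:
  assumes "c \<in> ell2" "\<And>i. cmod (d i) \<le> cmod (c i)"
  shows "d \<in> ell2"
  using assms(1) unfolding ell2_def mem_Collect_eq
  by (rule summable_on_comparison_test) (auto intro: power_mono assms(2))

lemma ell2_summable_product:
  assumes "c \<in> ell2" "d \<in> ell2"
  shows "(\<lambda>i. c i * cnj (d i)) summable_on UNIV"
proof -
  have 1: "(\<lambda>i. (cmod (c i))\<^sup>2 + (cmod (d i))\<^sup>2) summable_on UNIV"
    using assms by (auto simp: ell2_def intro: summable_on_add)
  have 2: "norm (c i * cnj (d i)) \<le> (cmod (c i))\<^sup>2 + (cmod (d i))\<^sup>2" for i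
  proof -
    have "0 \<le> cmod (c i) * cmod (d i)" by simp
    then show ?thesis
      using sum_squares_bound[of "cmod (c i)" "cmod (d i)"] by (simp only: norm_mult complex_mod_cnj)
  qed
  show ?thesis
    by (rule Infinite_Sum.abs_summable_summable)
      (rule Infinite_Sum.abs_summable_on_comparison_test'[OF 1 2])
qed

lemma ell2_subspace: "cfun.subspace ell2"
  unfolding cfun.subspace_def
proof (intro conjI ballI allI)
  show "0 \<in> ell2" by (simp add: ell2_def)
  fix c d :: "'a \<Rightarrow> complex" assume c: "c \<in> ell2"
  then show "cscale_fun z c \<in> ell2" for z
    by (auto simp: ell2_def cscale_fun_def norm_mult power_mult_distrib intro: summable_on_cmult_right)
  assume d: "d \<in> ell2"
  have "(\<lambda>i. 2 * (cmod (c i))\<^sup>2 + 2 * (cmod (d i))\<^sup>2) summable_on UNIV"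
    using c d by (intro summable_on_add summable_on_cmult_right) (auto simp: ell2_def)
  then show "c + d \<in> ell2"
    unfolding ell2_def mem_Collect_eq
  proof (rule summable_on_comparison_test)
    fix i
    have "(cmod ((c + d) i))\<^sup>2 \<le> (cmod (c i) + cmod (d i))\<^sup>2"
      by (intro power_mono) (auto intro: norm_triangle_ineq)
    also have "\<dots> \<le> 2 * (cmod (c i))\<^sup>2 + 2 * (cmod (d i))\<^sup>2"
      using sum_squares_bound[of "cmod (c i)" "cmod (d i)"] by (simp add: power2_sum)
    finally show "(cmod ((c + d) i))\<^sup>2 \<le> 2 * (cmod (c i))\<^sup>2 + 2 * (cmod (d i))\<^sup>2" .
  qed simp
qed

lemma ell2_ip_self: "Re (ell2_ip c c) = (\<Sum>\<^sub>\<infinity>i. (cmod (c i))\<^sup>2)"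
proof -
  have "ell2_ip c c = (\<Sum>\<^sub>\<infinity>i. complex_of_real ((cmod (c i))\<^sup>2))"
    unfolding ell2_ip_def by (simp only: complex_norm_square)
  also have "\<dots> = complex_of_real (\<Sum>\<^sub>\<infinity>i. (cmod (c i))\<^sup>2)"
  proof (rule infsum_bounded_linear_strong[OF _ bounded_linear_of_real])
    show "(\<lambda>i. complex_of_real ((cmod (c i))\<^sup>2)) summable_on UNIV
        \<longleftrightarrow> (\<lambda>i. (cmod (c i))\<^sup>2) summable_on UNIV"
      using summable_on_Re[of "\<lambda>i. complex_of_real ((cmod (c i))\<^sup>2)" UNIV]
        summable_on_of_real[of "\<lambda>i. (cmod (c i))\<^sup>2" UNIV]
      by (auto simp del: of_real_power)
  qed
  finally show ?thesis by simp
qed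

lemma ell2_norm_sq: "(form_norm ell2_ip c)\<^sup>2 = (\<Sum>\<^sub>\<infinity>i. (cmod (c i))\<^sup>2)"
  by (simp add: form_norm_def ell2_ip_self infsum_nonneg)

lemma ell2_finite_sum_le:
  assumes "c \<in> ell2" "finite F"
  shows "(\<Sum>i\<in>F. (cmod (c i))\<^sup>2) \<le> (form_norm ell2_ip c)\<^sup>2"
  unfolding ell2_norm_sq
  using assms by (intro finite_sum_le_infsum) (auto simp: ell2_def)

lemma ell2_coordinate_le:
  assumes "c \<in> ell2"
  shows "cmod (c i) \<le> form_norm ell2_ip c"
proof -
  have "(cmod (c i))\<^sup>2 \<le> (form_norm ell2_ip c)\<^sup>2"
    using ell2_finite_sum_le[OF assms, of "{i}"] by simp
  then show ?thesis
    by (rule power2_le_imp_le) (simp add: form_norm_def ell2_ip_self infsum_nonneg)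
qed

text \<open>Completeness: the coordinatewise limit \<open>f\<close> is the norm limit because a bound on all finite
  partial sums of \<open>u m - u n\<close> survives letting \<open>n\<close> tend to infinity.\<close>

lemma ell2_complete:
  assumes u: "\<And>n::nat. u n \<in> ell2"
    and c: "\<And>e. e > 0 \<Longrightarrow> \<exists>N. \<forall>m\<ge>N. \<forall>n\<ge>N. form_norm ell2_ip (u m - u n) < e"
  shows "\<exists>f\<in>ell2. (\<lambda>n. form_norm ell2_ip (u n - f)) \<longlonglongrightarrow> 0"
proof -
  have diff: "u m - u n \<in> ell2" for m n
    using cfun.subspace_diff[OF ell2_subspace] u by blast
  have "Cauchy (\<lambda>n. u n i)" for i
  proof (rule metric_CauchyI)
    fix e :: real assume "e > 0"
    from c[OF this] obtain N where N: "\<forall>m\<ge>N. \<forall>n\<ge>N. form_norm ell2_ip (u m - u n) < e" by blast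
    have "dist (u m i) (u n i) < e" if "m \<ge> N" "n \<ge> N" for m n
      using ell2_coordinate_le[OF diff[of m n], of i] N that by (force simp: dist_norm)
    then show "\<exists>N. \<forall>m\<ge>N. \<forall>n\<ge>N. dist (u m i) (u n i) < e" by blast
  qed
  then have "\<exists>l. (\<lambda>n. u n i) \<longlonglongrightarrow> l" for i
    by (simp add: Cauchy_convergent_iff convergent_def)
  then obtain f where f: "\<And>i. (\<lambda>n. u n i) \<longlonglongrightarrow> f i" by metis
  have bound: "\<exists>N. \<forall>m\<ge>N. u m - f \<in> ell2 \<and> (form_norm ell2_ip (u m - f))\<^sup>2 \<le> e\<^sup>2" if "e > 0" for e
  proof -
    from c[OF that] obtain N where
      N: "\<And>m n. m \<ge> N \<Longrightarrow> n \<ge> N \<Longrightarrow> form_norm ell2_ip (u m - u n) < e" by blast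
    have fin: "(\<Sum>i\<in>F. (cmod ((u m - f) i))\<^sup>2) \<le> e\<^sup>2" if "m \<ge> N" "finite F" for m F
    proof (rule tendsto_upperbound)
      show "(\<lambda>n. \<Sum>i\<in>F. (cmod ((u m - u n) i))\<^sup>2) \<longlonglongrightarrow> (\<Sum>i\<in>F. (cmod ((u m - f) i))\<^sup>2)"
        using f by (auto intro!: tendsto_intros)
      have "(\<Sum>i\<in>F. (cmod ((u m - u n) i))\<^sup>2) \<le> e\<^sup>2" if n: "n \<ge> N" for n
      proof -
        have "(\<Sum>i\<in>F. (cmod ((u m - u n) i))\<^sup>2) \<le> (form_norm ell2_ip (u m - u n))\<^sup>2"
          by (rule ell2_finite_sum_le[OF diff \<open>finite F\<close>])
        also have "\<dots> \<le> e\<^sup>2"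
          using N[OF \<open>m \<ge> N\<close> n] by (intro power_mono) (auto simp: form_norm_def ell2_ip_self infsum_nonneg)
        finally show ?thesis .
      qed
      then show "\<forall>\<^sub>F n in sequentially. (\<Sum>i\<in>F. (cmod ((u m - u n) i))\<^sup>2) \<le> e\<^sup>2"
        unfolding eventually_sequentially by blast
    qed simp
    have "u m - f \<in> ell2 \<and> (form_norm ell2_ip (u m - f))\<^sup>2 \<le> e\<^sup>2" if m: "m \<ge> N" for m
    proof
      have s: "(\<lambda>i. (cmod ((u m - f) i))\<^sup>2) summable_on UNIV"
        using fin[OF m] by (intro nonneg_bdd_above_summable_on bdd_aboveI2[where M = "e\<^sup>2"]) auto
      then show "u m - f \<in> ell2" by (simp add: ell2_def)
      show "(form_norm ell2_ip (u m - f))\<^sup>2 \<le> e\<^sup>2"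
        unfolding ell2_norm_sq using s fin[OF m] by (intro infsum_le_finite_sums) auto
    qed
    then show ?thesis by blast
  qed
  obtain N where "u N - f \<in> ell2" using bound[of 1] by auto
  then have "u N - (u N - f) \<in> ell2"
    using cfun.subspace_diff[OF ell2_subspace] u by blast
  then have fin: "f \<in> ell2" by simp
  have "(\<lambda>n. form_norm ell2_ip (u n - f)) \<longlonglongrightarrow> 0"
  proof (rule LIMSEQ_I)
    fix r :: real assume r: "r > 0"
    obtain N where N: "\<And>m. m \<ge> N \<Longrightarrow> (form_norm ell2_ip (u m - f))\<^sup>2 \<le> (r / 2)\<^sup>2"
      using bound[of "r / 2"] r by auto
    have "norm (form_norm ell2_ip (u m - f) - 0) < r" if "m \<ge> N" for m
      using power2_le_imp_le[OF N[OF that]] r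
      by (simp add: form_norm_def ell2_ip_self infsum_nonneg)
    then show "\<exists>N. \<forall>m\<ge>N. norm (form_norm ell2_ip (u m - f) - 0) < r" by blast
  qed
  with fin show ?thesis by blast
qed

lemma ell2_hilbert: "hilbert_space_on ell2 (ell2_ip :: ('i \<Rightarrow> complex) \<Rightarrow> _)"
proof -
  have "hermitian_form_on ell2 (ell2_ip :: ('i \<Rightarrow> complex) \<Rightarrow> _)"
    unfolding hermitian_form_on_def
  proof (intro conjI ballI allI)
    fix f g :: "'i \<Rightarrow> complex" assume f: "f \<in> ell2" and g: "g \<in> ell2"
    show "ell2_ip (cscale_fun c f) g = c * ell2_ip f g" for c
      by (simp add: ell2_ip_def cscale_fun_def mult.assoc infsum_cmult_right')
    show "ell2_ip g f = cnj (ell2_ip f g)"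
      by (simp add: ell2_ip_def infsum_cnj[symmetric] mult.commute)
    show "ell2_ip (f + g) h = ell2_ip f h + ell2_ip g h" if "h \<in> ell2" for h
      using infsum_add[OF ell2_summable_product[OF f that] ell2_summable_product[OF g that]]
      by (simp add: ell2_ip_def distrib_right)
  qed
  moreover have "0 < Re (ell2_ip f f)" if f: "f \<in> ell2" "f \<noteq> 0" for f :: "'i \<Rightarrow> complex"
  proof -
    obtain i where "f i \<noteq> 0" using f by (auto simp: fun_eq_iff)
    then have "0 < (\<Sum>i\<in>{i}. (cmod (f i))\<^sup>2)" by simp
    also have "\<dots> \<le> (\<Sum>\<^sub>\<infinity>i. (cmod (f i))\<^sup>2)"
      using ell2_finite_sum_le[OF f(1), of "{i}"] by (simp add: ell2_norm_sq)
    finally show ?thesis by (simp add: ell2_ip_self)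
  qed
  ultimately show ?thesis
    unfolding hilbert_space_on_def using ell2_subspace ell2_complete by blast
qed

section \<open>Kernels that are power series in the inner product\<close>

text \<open>Monomials are indexed by words in the coordinates rather than by multi-indices.  Different
  words can give the same monomial, but then \<open>(y\<^sup>*x)\<^sup>j\<close> expands over words of length \<open>j\<close> with all
  coefficients equal to one, and no multinomial coefficients occur.\<close>

definition word_monomial :: "'b::comm_monoid_mult ^ 'n \<Rightarrow> 'n list \<Rightarrow> 'b"
  where "word_monomial x w = (\<Prod>i\<leftarrow>w. x $ i)"

lemma finite_words_of_length: "finite {w :: 'n::finite list. length w = j}"
  using finite_lists_length_eq[of "UNIV :: 'n set" j] by simp

lemma sum_words_of_length:
  fixes t :: "'n::finite \<Rightarrow> 'b::comm_semiring_1"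
  shows "(\<Sum>w | length w = j. \<Prod>i\<leftarrow>w. t i) = (\<Sum>i\<in>UNIV. t i) ^ j"
proof (induction j)
  case 0
  then show ?case by simp
next
  case (Suc j)
  have "{w :: 'n list. length w = Suc j} = (\<lambda>(i, w). i # w) ` (UNIV \<times> {w. length w = j})"
    by (force simp: length_Suc_conv)
  then have "(\<Sum>w | length w = Suc j. \<Prod>i\<leftarrow>w. t i)
      = (\<Sum>(i, w)\<in>UNIV \<times> {w. length w = j}. t i * (\<Prod>i\<leftarrow>w. t i))"
    by (simp add: sum.reindex inj_on_def case_prod_unfold)
  also have "\<dots> = (\<Sum>i\<in>UNIV. t i) * (\<Sum>w | length w = j. \<Prod>i\<leftarrow>w. t i)"
    by (simp add: sum_product sum.cartesian_product)
  finally show ?case using Suc.IH by simp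
qed

lemma sums_words_by_length:
  fixes f :: "'n::finite list \<Rightarrow> 'b::banach"
  assumes "f summable_on UNIV"
  shows "(\<lambda>j. \<Sum>w | length w = j. f w) sums infsum f UNIV"
proof -
  let ?S = "SIGMA j:UNIV. {w :: 'n list. length w = j}"
  have "bij_betw snd ?S UNIV"
    by (rule bij_betw_byWitness[where f' = "\<lambda>w. (length w, w)"]) auto
  then have 1: "((\<lambda>p. f (snd p)) has_sum infsum f UNIV) ?S"
    using assms by (subst has_sum_reindex_bij_betw) auto
  have 2: "((\<lambda>w. f (snd (j, w))) has_sum (\<Sum>w | length w = j. f w)) {w. length w = j}" for j
    using has_sum_finite[OF finite_words_of_length] by simp
  show ?thesis by (rule has_sum_imp_sums, rule has_sum_SigmaD[OF 1]) (rule 2)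
qed

text \<open>Every finite set of words involves finitely many lengths, so the series of sums over the
  words of each length bounds all finite partial sums.\<close>

lemma summable_on_words:
  fixes f :: "'n::finite list \<Rightarrow> real"
  assumes nonneg: "\<And>w. f w \<ge> 0" and sum: "summable (\<lambda>j. \<Sum>w | length w = j. f w)"
  shows "f summable_on UNIV"
proof (rule nonneg_bdd_above_summable_on[OF nonneg], rule bdd_aboveI2)
  fix F :: "'n list set" assume "F \<in> {F. F \<subseteq> UNIV \<and> finite F}"
  then have F: "finite F" by simp
  let ?J = "length ` F"
  have "sum f F \<le> sum f (\<Union>j\<in>?J. {w. length w = j})"
    using F finite_words_of_length nonneg by (intro sum_mono2) auto
  also have "\<dots> = (\<Sum>j\<in>?J. \<Sum>w | length w = j. f w)"
    using F finite_words_of_length by (intro sum.UNION_disjoint) auto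
  also have "\<dots> \<le> (\<Sum>j. \<Sum>w | length w = j. f w)"
    using F nonneg by (intro sum_le_suminf sum) (auto intro: sum_nonneg)
  finally show "sum f F \<le> (\<Sum>j. \<Sum>w | length w = j. f w)" .
qed

text \<open>The weight is a square root because the inner product of two features must carry \<open>a j\<close>, and
  the monomial is conjugated so that \<open>ell2_ip c (word_feature a x)\<close>, where the second argument is
  conjugated once more, is holomorphic in \<open>x\<close>.\<close>

definition word_feature :: "(nat \<Rightarrow> real) \<Rightarrow> complex ^ 'n \<Rightarrow> 'n list \<Rightarrow> complex"
  where "word_feature a x w = of_real (sqrt (a (length w))) * cnj (word_monomial x w)"

text \<open>The squared moduli of the monomials of degree \<open>j\<close> add up to \<open>norm x ^ (2 * j)\<close>, a geometric series
  on the ball.\<close>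

lemma word_monomial_ell2:
  assumes x: "x \<in> (unit_ball :: (complex ^ 'n) set)"
  shows "word_monomial x \<in> ell2"
proof -
  have sq: "(cmod (word_monomial x w))\<^sup>2 = (\<Prod>i\<leftarrow>w. (cmod (x $ i))\<^sup>2)" for w
    by (induction w) (auto simp: word_monomial_def norm_mult power_mult_distrib)
  have nx: "(\<Sum>i\<in>UNIV. (cmod (x $ i))\<^sup>2) = (norm x)\<^sup>2"
    by (simp add: norm_vec_def L2_set_def sum_nonneg)
  have "norm x < 1" using x by simp
  then have "(norm x)\<^sup>2 < 1" by (simp add: power_less_one_iff abs_square_less_1)
  then have "summable (\<lambda>j. \<Sum>w | length w = j. (cmod (word_monomial x w))\<^sup>2)"
    unfolding sq sum_words_of_length nx by (intro summable_geometric) simp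
  then show ?thesis by (simp add: ell2_def summable_on_words)
qed

lemma word_feature_ell2:
  assumes a: "\<And>j. 0 \<le> a j" "\<And>j. a j \<le> 1" and x: "x \<in> unit_ball"
  shows "word_feature a x \<in> ell2"
proof (rule ell2_dominated[OF word_monomial_ell2[OF x]])
  show "cmod (word_feature a x w) \<le> cmod (word_monomial x w)" for w
    using a by (simp add: word_feature_def norm_mult mult_left_le_one_le)
qed

text \<open>Summing over the words of each length separately turns the inner product of two features
  into the power series in \<open>y\<^sup>*x\<close>; in particular this series converges on the ball.\<close>

lemma power_kernel_feature:
  assumes a: "\<And>j. 0 \<le> a j" "\<And>j. a j \<le> 1"
    and x: "x \<in> unit_ball" and y: "y \<in> unit_ball"
  shows "(\<lambda>j. of_real (a j) * cdot y x ^ j) sums ell2_ip (word_feature a y) (word_feature a x)"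
proof -
  let ?f = "\<lambda>w. word_feature a y w * cnj (word_feature a x w)"
  have "(\<lambda>j. \<Sum>w | length w = j. ?f w) sums ell2_ip (word_feature a y) (word_feature a x)"
    unfolding ell2_ip_def
    by (intro sums_words_by_length ell2_summable_product word_feature_ell2 a x y)
  moreover have "(\<Sum>w | length w = j. ?f w) = of_real (a j) * cdot y x ^ j" for j
  proof -
    have m: "cnj (word_monomial y w) * word_monomial x w = (\<Prod>i\<leftarrow>w. cnj (y $ i) * x $ i)" for w
      by (induction w) (auto simp: word_monomial_def)
    have s: "complex_of_real (sqrt (a j)) * of_real (sqrt (a j)) = of_real (a j)"
      using a by (simp flip: of_real_mult)
    have "?f w = of_real (a j) * (\<Prod>i\<leftarrow>w. cnj (y $ i) * x $ i)" if "length w = j" for w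
      unfolding m[symmetric] s[symmetric] using that by (simp add: word_feature_def mult_ac)
    then have "(\<Sum>w | length w = j. ?f w)
        = (\<Sum>w | length w = j. of_real (a j) * (\<Prod>i\<leftarrow>w. cnj (y $ i) * x $ i))"
      by (intro sum.cong) auto
    then show ?thesis
      by (simp add: sum_distrib_left[symmetric] sum_words_of_length cdot_def)
  qed
  ultimately show ?thesis by simp
qed

abbreviation word_series :: "(nat \<Rightarrow> real) \<Rightarrow> ('n list \<Rightarrow> complex) \<Rightarrow> complex ^ 'n \<Rightarrow> complex"
  where "word_series a \<equiv> pullback unit_ball ell2_ip (word_feature a)"

text \<open>The concrete model used for all three kernels: the functions \<open>\<Sum>\<^sub>w c w * sqrt (a (length w)) * x\<^sup>w\<close>
  with square-summable \<open>c\<close>.\<close>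

lemma rkhs_power_kernel:
  fixes k :: "complex ^ 'n \<Rightarrow> complex ^ 'n \<Rightarrow> complex"
  assumes a: "\<And>j. 0 \<le> a j" "\<And>j. a j \<le> 1"
    and k: "\<And>x y. x \<in> unit_ball \<Longrightarrow> y \<in> unit_ball \<Longrightarrow>
      (\<lambda>j. of_real (a j) * cdot y x ^ j) sums k x y"
  shows "rkhs unit_ball k = word_series a ` ell2" and "cfun.subspace (rkhs unit_ball k)"
proof -
  interpret hilbert_fun ell2 "ell2_ip :: ('n list \<Rightarrow> complex) \<Rightarrow> _"
    by unfold_locales (rule ell2_hilbert)
  have *: "word_feature a x \<in> ell2" if "x \<in> unit_ball" for x :: "complex ^ 'n"
    using a that by (rule word_feature_ell2)
  have **: "k x y = ell2_ip (word_feature a y) (word_feature a x)"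
    if "x \<in> unit_ball" "y \<in> unit_ball" for x y
    using k power_kernel_feature[of a, OF a] that sums_unique2 by blast
  show 1: "rkhs unit_ball k = word_series a ` ell2"
    using * ** by (rule rkhs_feature_map(1))
  show "cfun.subspace (rkhs unit_ball k)"
    unfolding 1 using * ** by (rule rkhs_feature_map(2))
qed

lemma power_kernel_sums:
  fixes x y :: "complex ^ 'n"
  assumes a: "\<And>j. 0 \<le> a j" "\<And>j. a j \<le> 1" and "x \<in> unit_ball" "y \<in> unit_ball"
  shows "(\<lambda>j. of_real (a j) * cdot y x ^ j) sums power_kernel a x y"
  unfolding power_kernel_def
  using power_kernel_feature[OF assms] by (simp add: sums_iff)

text \<open>Read off from the convergence of the kernel series with all coefficients one, which is the
  geometric series in \<open>y\<^sup>*x\<close>.\<close>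

lemma cmod_cdot_less_1:
  assumes "x \<in> unit_ball" "y \<in> unit_ball"
  shows "cmod (cdot y x) < 1"
proof -
  have "summable (\<lambda>j. of_real 1 * cdot y x ^ j)"
    using power_kernel_feature[of "\<lambda>_. 1", OF _ _ assms] by (auto simp: sums_iff)
  then show ?thesis by (simp add: summable_geometric_iff)
qed

lemma omega_kernel_sums:
  assumes "x \<in> unit_ball" "y \<in> unit_ball"
  shows "(\<lambda>j. of_real 1 * cdot y x ^ j) sums omega_kernel x y"
  using geometric_sums[OF cmod_cdot_less_1[OF assms]] by (simp add: omega_kernel_def)

text \<open>The weights of the kernel can be moved into the coefficient family; for weights at most one
  this is the inclusion into the space of the kernel with all coefficients one.\<close>

lemma word_series_rescale:
  "word_series a c = word_series (\<lambda>_. 1) (\<lambda>w. of_real (sqrt (a (length w))) * c w)"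
  by (simp add: pullback_def ell2_ip_def word_feature_def fun_eq_iff mult_ac)

lemma word_series_subset_omega:
  assumes "\<And>j. 0 \<le> a j" "\<And>j. a j \<le> 1"
  shows "word_series a ` ell2 \<subseteq> word_series (\<lambda>_. 1) ` ell2"
proof
  fix f assume "f \<in> word_series a ` ell2"
  then obtain c where c: "c \<in> ell2" and f: "f = word_series a c" by blast
  have "(\<lambda>w. of_real (sqrt (a (length w))) * c w) \<in> ell2"
    by (rule ell2_dominated[OF c]) (use assms in \<open>simp add: norm_mult mult_left_le_one_le\<close>)
  then show "f \<in> word_series (\<lambda>_. 1) ` ell2" using f word_series_rescale by blast
qed

lemma norm_axis_eq: "norm (axis i z :: complex ^ 'n) = cmod z"
  by (simp add: norm_vec_def L2_set_def axis_def if_distrib[where f = cmod] if_distrib[where f = "\<lambda>t. t\<^sup>2"] cong: if_cong)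

lemma word_monomial_axis:
  "word_monomial (axis i z :: complex ^ 'n) w = (if w = replicate (length w) i then z ^ length w else 0)"
  by (induction w) (auto simp: word_monomial_def axis_def)

text \<open>On a coordinate axis only the words that repeat one letter survive, so the function becomes
  a power series in one variable.  Its coefficient of degree \<open>j\<close> contains the factor
  \<open>sqrt (a j)\<close> and hence vanishes when \<open>a j = 0\<close>.\<close>

lemma word_series_axis_sums:
  assumes a: "\<And>j. 0 \<le> a j" "\<And>j. a j \<le> 1" and c: "c \<in> ell2" and z: "cmod z < 1"
  shows "(\<lambda>j. of_real (sqrt (a j)) * c (replicate j i) * z ^ j) sums word_series a c (axis i z)"
proof -
  have ball: "axis i z \<in> unit_ball" using z by (simp add: norm_axis_eq)
  let ?f = "\<lambda>w. c w * cnj (word_feature a (axis i z) w)"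
  have "(\<lambda>j. \<Sum>w | length w = j. ?f w) sums word_series a c (axis i z)"
    unfolding pullback_def ell2_ip_def using ball
    by (simp, intro sums_words_by_length ell2_summable_product word_feature_ell2 a ball c)
  moreover have "(\<Sum>w | length w = j. ?f w) = of_real (sqrt (a j)) * c (replicate j i) * z ^ j" for j
  proof -
    have "(\<Sum>w | length w = j. ?f w)
        = (\<Sum>w | length w = j. if w = replicate j i
             then of_real (sqrt (a j)) * c (replicate j i) * z ^ j else 0)"
      by (intro sum.cong) (auto simp: word_feature_def word_monomial_axis)
    then show ?thesis by (simp add: finite_words_of_length)
  qed
  ultimately show ?thesis by simp
qed

lemma power_series_coefficients_unique:
  fixes d :: "nat \<Rightarrow> complex"
  assumes s: "\<And>z. cmod z < 1 \<Longrightarrow> (\<lambda>j. d j * z ^ j) sums 0"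
  shows "d k = 0"
proof -
  let ?F = "Abs_fps d"
  have "ereal (1/2) \<le> conv_radius d"
    using s by (intro conv_radius_geI_ex' sums_summable[of _ 0]) auto
  then have r: "fps_conv_radius ?F > 0"
    by (simp add: fps_conv_radius_def order.strict_trans2[of 0 "ereal (1/2)"])
  have "\<forall>\<^sub>F z in nhds 0. z \<in> ball (0::complex) 1" by (intro eventually_nhds_in_open) auto
  then have "\<forall>\<^sub>F z in nhds 0. eval_fps ?F z = eval_fps 0 z"
    by eventually_elim (use s in \<open>auto simp: eval_fps_def sums_iff\<close>)
  then have "?F = 0" using r by (intro eval_fps_eqD) auto
  then show ?thesis by (metis fps_nth_Abs_fps fps_zero_nth)
qed

theorem theorem4p3p3:
  fixes a :: "nat \<Rightarrow> real"
  assumes "krein_kernel (unit_ball :: (complex ^ 'n) set) (power_kernel a)"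
    and "\<And>k. \<bar>a k\<bar> < 1"
    and "\<exists>k. a k = 0"
  shows "cfun.subspace (induced_rkks a :: (complex ^ 'n \<Rightarrow> complex) set) \<and>
         (induced_rkks a :: (complex ^ 'n \<Rightarrow> complex) set) \<subset> rkhs unit_ball omega_kernel"
proof -
  let ?H = "\<lambda>b. (word_series b :: _ \<Rightarrow> complex ^ 'n \<Rightarrow> complex) ` ell2"
  \<comment> \<open>\<open>p\<close> and \<open>q\<close> are the coefficient sequences of the positive kernels \<open>K\<^sub>+\<close> and \<open>-K\<^sub>-\<close>.\<close>
  define p where "p j = (if a j > 0 then a j else 0)" for j
  define q where "q j = (if a j < 0 then - a j else 0)" for j
  have p: "0 \<le> p j" "p j \<le> 1" and q: "0 \<le> q j" "q j \<le> 1" for j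
    using assms(2)[of j] by (auto simp: p_def q_def)
  have pos: "(\<lambda>j. of_real (p j) * cdot y x ^ j) sums power_kernel_pos a x y"
    if "x \<in> unit_ball" "y \<in> unit_ball" for x y :: "complex ^ 'n"
    using power_kernel_sums[of p, OF p that] by (simp add: power_kernel_pos_def p_def[abs_def])
  have neg: "(\<lambda>j. of_real (q j) * cdot y x ^ j) sums (- power_kernel_neg a x y)"
    if "x \<in> unit_ball" "y \<in> unit_ball" for x y :: "complex ^ 'n"
  proof -
    have "power_kernel_neg a x y = - power_kernel q x y"
    proof -
      have "(\<lambda>j. - (of_real (q j) * cdot y x ^ j)) sums (- power_kernel q x y)"
        by (intro sums_minus power_kernel_sums q that)
      moreover have "- (of_real (q j) * cdot y x ^ j)
          = of_real (if a j < 0 then a j else 0) * cdot y x ^ j" for j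
        by (simp add: q_def)
      ultimately show ?thesis
        by (simp add: power_kernel_neg_def power_kernel_def[of "\<lambda>j. if a j < 0 then a j else 0"] sums_iff)
    qed
    then show ?thesis using power_kernel_sums[of q, OF q that] by simp
  qed
  have Hp: "rkhs unit_ball (power_kernel_pos a) = ?H p" "cfun.subspace (?H p)"
    using rkhs_power_kernel[of p, OF p pos] by simp_all
  have Hq: "rkhs unit_ball (\<lambda>x y. - power_kernel_neg a x y) = ?H q" "cfun.subspace (?H q)"
    using rkhs_power_kernel[of q, OF q neg] by simp_all
  have Ho: "rkhs unit_ball omega_kernel = ?H (\<lambda>_. 1)"
    "cfun.subspace (rkhs unit_ball omega_kernel :: (complex ^ 'n \<Rightarrow> complex) set)"
    using rkhs_power_kernel[of "\<lambda>_. 1", OF _ _ omega_kernel_sums] by simp_all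
  have ind: "induced_rkks a = {f + g |f g. f \<in> ?H p \<and> g \<in> ?H q}"
    unfolding induced_rkks_def Hp(1) Hq(1) by (rule refl)
  have "cfun.subspace (induced_rkks a :: (complex ^ 'n \<Rightarrow> complex) set)"
    unfolding ind using cfun.subspace_sums[OF Hp(2) Hq(2)] by simp
  moreover have "(induced_rkks a :: (complex ^ 'n \<Rightarrow> complex) set) \<subseteq> rkhs unit_ball omega_kernel"
    using word_series_subset_omega[of p, OF p] word_series_subset_omega[of q, OF q]
      cfun.subspace_add[OF Ho(2)] unfolding ind Ho(1) by blast
  moreover have "induced_rkks a \<noteq> (rkhs unit_ball omega_kernel :: (complex ^ 'n \<Rightarrow> complex) set)"
  proof
    assume eq: "induced_rkks a = (rkhs unit_ball omega_kernel :: (complex ^ 'n \<Rightarrow> complex) set)"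
    obtain k where k: "a k = 0" using assms(3) by blast
    define i :: 'n where "i = undefined"
    \<comment> \<open>\<open>e\<close> represents the monomial \<open>x\<^sub>i\<^sup>k\<close>, and \<open>l\<close> collects the Taylor coefficients along the
      \<open>i\<close>-th axis of the difference of both sides of \<open>sum\<close>.\<close>
    define e :: "'n list \<Rightarrow> complex" where "e w = (if w = replicate k i then 1 else 0)" for w
    have e: "e \<in> ell2"
      unfolding ell2_def mem_Collect_eq
      by (rule finite_nonzero_values_imp_summable_on)
        (rule finite_subset[of _ "{replicate k i}"], auto simp: e_def)
    then have "word_series (\<lambda>_. 1) e \<in> {f + g |f g. f \<in> ?H p \<and> g \<in> ?H q}"
      using eq ind Ho(1) by blast
    then obtain c d where c: "c \<in> ell2" and d: "d \<in> ell2"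
      and sum: "word_series (\<lambda>_. 1) e = word_series p c + word_series q d" by blast
    define l where "l j = e (replicate j i)
      - (of_real (sqrt (p j)) * c (replicate j i) + of_real (sqrt (q j)) * d (replicate j i))" for j
    have "(\<lambda>j. l j * z ^ j) sums 0" if z: "cmod z < 1" for z
    proof -
      have "(\<lambda>j. of_real (sqrt 1) * e (replicate j i) * z ^ j
          - (of_real (sqrt (p j)) * c (replicate j i) * z ^ j
             + of_real (sqrt (q j)) * d (replicate j i) * z ^ j))
        sums (word_series (\<lambda>_. 1) e (axis i z)
          - (word_series p c (axis i z) + word_series q d (axis i z)))"
        by (intro sums_diff sums_add word_series_axis_sums c d e z p q) auto
      then show ?thesis by (simp add: sum l_def algebra_simps)
    qed
    then have "l k = 0" by (rule power_series_coefficients_unique)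
    moreover have "l k = 1" using k by (simp add: l_def e_def p_def q_def)
    ultimately show False by simp
  qed
  ultimately show ?thesis by blast
qed

end
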